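(* Let $A=\begin{pmatrix}a&b\\c&d\end{pmatrix}\colon\mathbb{R}\to\mathfrak{sp}(\mathbb{R}^{2n})$. If $s\colon\mathbb{R}\to\mathrm{D}(\mathbb{R}^n)$ solves the Riccati equation $$\partial s=c+ds-s(a+bs),$$ then $u\coloneqq(\mathrm{id}-\mathrm{i}s)(\mathrm{id}+\mathrm{i}s)^{-1}\colon\mathbb{R}\to\mathrm{U}_{\mathrm{sym}}(\mathbb{C}^n)$ satisfies $$\partial u=C+Du-u(D^\ast+C^\ast u),$$ where $$C\coloneqq\tfrac12\bigl(a-d-\mathrm{i}(b+c)\bigr),\qquad D\coloneqq\tfrac12\bigl(a+d+\mathrm{i}(b-c)\bigr).$$
   Context: $\mathfrak{sp}(\mathbb{R}^{2n})$ is the Lie algebra of real $2n\times2n$ block matrices $\begin{pmatrix}a&b\\c&d\end{pmatrix}$ with $n\times n$ blocks, $b$ and $c$ symmetric and $a=-d^{\mathrm{T}}$; so $a,b,c,d$ are functions of $x\in\mathbb{R}$, and $\partial$ is the derivative with respect to $x$. $\mathrm{D}(\mathbb{R}^n)$ is the space of real symmetric $n\times n$ matrices, and $\mathrm{U}_{\mathrm{sym}}(\mathbb{C}^n)$ is the manifold of $n\times n$ complex matrices that are both unitary and symmetric ($u^{\mathrm{T}}=u$). The superscript $\ast$ denotes the entrywise complex conjugate (without transpose). *)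

theory Defs
  imports "HOL-Analysis.Analysis"
begin

(* The 2n x 2n matrices are indexed by the sum type 'n + 'n, of cardinality 2 * CARD('n). *)
definition block_matrix ::
  "'a ^ 'n ^ 'n \<Rightarrow> 'a ^ 'n ^ 'n \<Rightarrow> 'a ^ 'n ^ 'n \<Rightarrow> 'a ^ 'n ^ 'n \<Rightarrow> 'a ^ ('n::finite + 'n) ^ ('n + 'n)"
where
  "block_matrix a b c d =
    (\<chi> i j. case i of
       Inl k \<Rightarrow> (case j of Inl l \<Rightarrow> a $ k $ l | Inr l \<Rightarrow> b $ k $ l)
     | Inr k \<Rightarrow> (case j of Inl l \<Rightarrow> c $ k $ l | Inr l \<Rightarrow> d $ k $ l))"

definition sp_algebra :: "(real ^ ('n::finite + 'n) ^ ('n + 'n)) set" where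
  "sp_algebra = {block_matrix a b c d | a b c d.
     transpose b = b \<and> transpose c = c \<and> a = - transpose d}"

definition sym_matrices :: "(real ^ 'n ^ 'n) set" where
  "sym_matrices = {s. transpose s = s}"

(* Entrywise complex conjugate, without transposition. *)
definition conj_matrix :: "complex ^ 'n ^ 'm \<Rightarrow> complex ^ 'n ^ 'm" where
  "conj_matrix M = map_matrix cnj M"

definition unitary_sym :: "(complex ^ 'n ^ 'n) set" where
  "unitary_sym = {u. u ** transpose (conj_matrix u) = mat 1 \<and>
     transpose (conj_matrix u) ** u = mat 1 \<and> transpose u = u}"

definition complex_matrix :: "real ^ 'n ^ 'm \<Rightarrow> complex ^ 'n ^ 'm" where
  "complex_matrix M = map_matrix complex_of_real M"

definition cscale_matrix :: "complex \<Rightarrow> complex ^ 'n ^ 'm \<Rightarrow> complex ^ 'n ^ 'm"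
  (infixr "*\<^sub>C" 75)
where
  "z *\<^sub>C M = map_matrix ((*) z) M"

end

theory Submission
  imports Defs
begin

text \<open>Put \<open>P = 1 + \<i>s\<close>; it is invertible because \<open>P (1 - \<i>s) = 1 + s\<^sup>2\<close> is positive definite. Since
  \<open>1 - \<i>s = 2 - P\<close>, we have \<open>u = 2 P\<inverse> - 1\<close>, hence \<open>\<partial>u = - 2\<i> P\<inverse> (\<partial>s) P\<inverse>\<close>. As \<open>u P = P u = 1 - \<i>s\<close>,
  multiplying the claimed equation by \<open>P\<close> on both sides turns it into a polynomial identity in
  \<open>s, a, b, c, d\<close>.\<close>

section \<open>The derivative of a matrix inverse\<close>

lemma matrix_mul_distribs:
  fixes M N :: "'a::ring_1 ^ 'n ^ 'm" and K L :: "'a ^ 'p ^ 'n"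
  shows matrix_mul_add_left: "(M + N) ** K = M ** K + N ** K"
    and matrix_mul_diff_left: "(M - N) ** K = M ** K - N ** K"
    and matrix_mul_diff_right: "M ** (K - L) = M ** K - M ** L"
  by (simp_all add: matrix_matrix_mult_def vec_eq_iff sum.distrib sum_subtractf
      algebra_simps)

text \<open>In finite dimension bilinearity already implies boundedness. This supplies both the norm
  estimate and the limit rule for products.\<close>

lemma bounded_bilinear_matrix_mul:
  "bounded_bilinear ((**) :: 'a::{real_normed_field,euclidean_space} ^ 'n ^ 'm \<Rightarrow>
     'a ^ 'p ^ 'n \<Rightarrow> 'a ^ 'p ^ 'm)"
  unfolding bilinear_conv_bounded_bilinear [symmetric] bilinear_def
  by (auto intro!: linearI simp: matrix_matrix_mult_def vec_eq_iff sum.distrib algebra_simps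
      scaleR_sum_right)

text \<open>The quotient form suits the matrix inverse: its difference quotient is a product of
  convergent factors, so its limit can be read off factor by factor.\<close>

lemma has_vector_derivative_iff_quotient:
  "(f has_vector_derivative f') (at x within S) \<longleftrightarrow>
     ((\<lambda>y. (f y - f x) /\<^sub>R (y - x)) \<longlongrightarrow> f') (at x within S)"
proof -
  have "norm (f y - f x - (y - x) *\<^sub>R f') / norm (y - x) = norm ((f y - f x) /\<^sub>R (y - x) - f')"
    if "y \<noteq> x" for y
  proof -
    have "(f y - f x) /\<^sub>R (y - x) - f' = (f y - f x - (y - x) *\<^sub>R f') /\<^sub>R (y - x)"
      using that by (simp add: scaleR_diff_right)
    then show ?thesis by (simp add: divide_inverse_commute)
  qed
  then have "((\<lambda>y. norm (f y - f x - (y - x) *\<^sub>R f') / norm (y - x)) \<longlongrightarrow> 0) (at x within S) \<longleftrightarrow>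
      ((\<lambda>y. norm ((f y - f x) /\<^sub>R (y - x) - f')) \<longlongrightarrow> 0) (at x within S)"
    by (intro tendsto_cong) (auto simp: eventually_at_filter)
  then show ?thesis
    by (simp add: has_vector_derivative_def has_derivative_iff_norm bounded_linear_scaleR_left
        tendsto_norm_zero_iff LIM_zero_iff)
qed

text \<open>Differentiability of \<open>g\<close> is a conclusion: its continuity comes from the estimate
  \<open>norm (g y) \<le> norm (g x) + K\<^sup>2 * norm (g y) * norm (f y - f x) * norm (g x)\<close>.\<close>

lemma has_vector_derivative_matrix_inverse:
  fixes f g :: "real \<Rightarrow> 'a::{real_normed_field,euclidean_space} ^ 'n ^ 'n"
  assumes f: "(f has_vector_derivative f') (at x)"
    and inv: "\<And>y. f y ** g y = mat 1"
  shows "(g has_vector_derivative - (g x ** f' ** g x)) (at x)"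
proof -
  interpret mm: bounded_bilinear "(**) :: 'a ^ 'n ^ 'n \<Rightarrow> 'a ^ 'n ^ 'n \<Rightarrow> 'a ^ 'n ^ 'n"
    by (rule bounded_bilinear_matrix_mul)
  have inv': "g y ** f y = mat 1" for y
    using inv matrix_left_right_inverse by blast
  \<comment> \<open>The resolvent identity, which reduces increments of \<open>g\<close> to
    increments of \<open>f\<close>.\<close>
  have diff: "g y - g x = - (g y ** (f y - f x) ** g x)" for y
  proof -
    have "g y ** (f y - f x) ** g x = (g y ** f y) ** g x - g y ** (f x ** g x)"
      by (simp add: matrix_mul_distribs matrix_mul_assoc)
    also have "\<dots> = g x - g y"
      by (simp add: inv inv')
    finally show ?thesis by simp
  qed
  obtain K where K: "K > 0" "\<And>(M :: 'a ^ 'n ^ 'n) (N :: 'a ^ 'n ^ 'n). norm (M ** N) \<le> norm M * norm N * K"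
    using mm.pos_bounded by blast
  have bound: "norm (g y - g x) \<le> norm (g y) * (K\<^sup>2 * norm (g x) * norm (f y - f x))" for y
  proof -
    have "norm (g y - g x) = norm (g y ** (f y - f x) ** g x)"
      by (simp add: diff)
    also have "\<dots> \<le> norm (g y ** (f y - f x)) * norm (g x) * K"
      by (rule K)
    also have "\<dots> \<le> (norm (g y) * norm (f y - f x) * K) * norm (g x) * K"
      using K by (intro mult_right_mono) auto
    finally show ?thesis
      by (simp add: power2_eq_square mult_ac)
  qed
  define e where "e y = K\<^sup>2 * norm (g x) * norm (f y - f x)" for y
  have f_cont: "f \<midarrow>x\<rightarrow> f x"
    using f has_vector_derivative_continuous isCont_def by blast
  have e0: "e \<midarrow>x\<rightarrow> 0"
    unfolding e_def using f_cont
    by (intro tendsto_mult_right_zero tendsto_norm_zero) (simp add: LIM_zero_iff)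
  \<comment> \<open>Below the threshold 1/2 the term \<open>norm (g y) * e y\<close> can be absorbed
    into the left-hand side, which bounds \<open>norm (g y)\<close> near \<open>x\<close>.\<close>
  have "\<forall>\<^sub>F y in at x. e y < 1/2"
    using e0 by (rule order_tendstoD) simp
  then have "\<forall>\<^sub>F y in at x. norm (g y - g x) \<le> 2 * norm (g x) * e y"
  proof eventually_elim
    case (elim y)
    have e_nonneg: "0 \<le> e y" by (simp add: e_def)
    have "norm (g y) \<le> norm (g x) + norm (g y - g x)"
      by (rule norm_triangle_sub)
    also have "\<dots> \<le> norm (g x) + norm (g y) * e y"
      using bound by (simp add: e_def)
    also have "\<dots> \<le> norm (g x) + norm (g y) * (1/2)"
      using elim by (intro add_left_mono mult_left_mono) auto
    finally have "norm (g y) \<le> 2 * norm (g x)" by simp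
    then have "norm (g y) * e y \<le> 2 * norm (g x) * e y"
      using e_nonneg by (rule mult_right_mono)
    with bound [of y] show ?case
      unfolding e_def by (rule order_trans)
  qed
  moreover have "(\<lambda>y. 2 * norm (g x) * e y) \<midarrow>x\<rightarrow> 0"
    using e0 by (rule tendsto_mult_right_zero)
  ultimately have "(\<lambda>y. g y - g x) \<midarrow>x\<rightarrow> 0"
    by (rule Lim_null_comparison)
  then have g_cont: "g \<midarrow>x\<rightarrow> g x"
    by (simp add: LIM_zero_iff)
  have "(\<lambda>y. (f y - f x) /\<^sub>R (y - x)) \<midarrow>x\<rightarrow> f'"
    using f by (simp add: has_vector_derivative_iff_quotient)
  then have "(\<lambda>y. - (g y ** ((f y - f x) /\<^sub>R (y - x)) ** g x)) \<midarrow>x\<rightarrow> - (g x ** f' ** g x)"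
    by (intro tendsto_intros mm.tendsto g_cont)
  moreover have "- (g y ** ((f y - f x) /\<^sub>R (y - x)) ** g x) = (g y - g x) /\<^sub>R (y - x)" for y
    by (simp add: diff mm.scaleR_left mm.scaleR_right)
  ultimately show ?thesis
    by (simp add: has_vector_derivative_iff_quotient)
qed

section \<open>Complex scalars, conjugation and the embedding of real matrices\<close>

lemma matrix_mul_cscale [simp]:
  fixes M :: "complex ^ 'n ^ 'm" and N :: "complex ^ 'p ^ 'n"
  shows "(z *\<^sub>C M) ** N = z *\<^sub>C (M ** N)"
    and "M ** (z *\<^sub>C N) = z *\<^sub>C (M ** N)"
  by (simp_all add: matrix_matrix_mult_def cscale_matrix_def vec_eq_iff sum_distrib_left mult_ac)

lemma cscale_matrix_nth [simp]: "(z *\<^sub>C M) $ i $ j = z * M $ i $ j"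
  by (simp add: cscale_matrix_def)

lemma transpose_cscale [simp]: "transpose (z *\<^sub>C M) = z *\<^sub>C transpose M"
  by (simp add: transpose_def vec_eq_iff)

lemma transpose_add [simp]: "transpose (M + N) = transpose M + transpose N"
  by (simp add: transpose_def vec_eq_iff)

lemma transpose_diff [simp]: "transpose (M - N) = transpose M - transpose N"
  by (simp add: transpose_def vec_eq_iff)

lemma conj_matrix_simps [simp]:
  "conj_matrix (M + N) = conj_matrix M + conj_matrix N"
  "conj_matrix (M - N) = conj_matrix M - conj_matrix N"
  "conj_matrix (z *\<^sub>C M) = cnj z *\<^sub>C conj_matrix M"
  "conj_matrix (complex_matrix S) = complex_matrix S"
  by (simp_all add: conj_matrix_def complex_matrix_def vec_eq_iff)

lemma conj_matrix_mat_1 [simp]: "conj_matrix (mat 1) = mat 1"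
  by (simp add: conj_matrix_def vec_eq_iff mat_def)

lemma conj_matrix_mul [simp]: "conj_matrix (M ** N) = conj_matrix M ** conj_matrix N"
  by (simp add: conj_matrix_def vec_eq_iff matrix_matrix_mult_def)

lemma complex_matrix_simps [simp]:
  "complex_matrix (S + T) = complex_matrix S + complex_matrix T"
  "complex_matrix (S - T) = complex_matrix S - complex_matrix T"
  "complex_matrix (transpose S) = transpose (complex_matrix S)"
  by (simp_all add: complex_matrix_def vec_eq_iff transpose_def)

lemma complex_matrix_mat_1 [simp]: "complex_matrix (mat 1) = mat 1"
  by (simp add: complex_matrix_def vec_eq_iff mat_def)

lemma complex_matrix_mul [simp]:
  "complex_matrix (S ** T) = complex_matrix S ** complex_matrix T"
  by (simp add: complex_matrix_def vec_eq_iff matrix_matrix_mult_def)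

lemma bounded_linear_i_complex_matrix:
  "bounded_linear (\<lambda>S. \<i> *\<^sub>C complex_matrix S)"
  unfolding linear_conv_bounded_linear [symmetric]
  by (rule linearI) (simp_all add: complex_matrix_def vec_eq_iff complex_eq_iff)

section \<open>The Cayley transform of a real symmetric matrix\<close>

lemma invertible_mat_1_add_square:
  fixes S :: "real ^ 'n ^ 'n"
  assumes "transpose S = S"
  shows "invertible (mat 1 + S ** S)"
proof -
  have "v = 0" if "(mat 1 + S ** S) *v v = 0" for v
  proof -
    have "0 = v \<bullet> ((mat 1 + S ** S) *v v)"
      using that by simp
    also have "\<dots> = v \<bullet> v + v \<bullet> (S *v (S *v v))"
      by (simp add: matrix_vector_mult_add_rdistrib inner_add_right matrix_vector_mul_assoc)
    \<comment> \<open>Symmetry moves one \<open>S\<close> to the other factor. The pairing becomes a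
      sum of two squares, and its vanishing forces \<open>v = 0\<close>.\<close>
    also have "v \<bullet> (S *v (S *v v)) = (S *v v) \<bullet> (S *v v)"
      by (metis assms dot_lmul_matrix vector_transpose_matrix)
    finally show "v = 0"
      by (smt (verit) inner_ge_zero inner_eq_zero_iff)
  qed
  then show ?thesis
    by (simp add: invertible_left_inverse matrix_left_invertible_ker)
qed

text \<open>If \<open>W\<close> inverts \<open>1 + S\<^sup>2 = (1 + \<i>S)(1 - \<i>S)\<close>, then
  \<open>(1 - \<i>S) W\<close> is a right inverse, and for square matrices a one-sided inverse is
  enough.\<close>

lemma invertible_mat_1_add_i_symmetric:
  fixes S :: "real ^ 'n ^ 'n"
  assumes "transpose S = S"
  shows "invertible (mat 1 + \<i> *\<^sub>C complex_matrix S)"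
proof -
  obtain W where W: "(mat 1 + S ** S) ** W = mat 1"
    using invertible_mat_1_add_square [OF assms] unfolding invertible_def by blast
  have "(mat 1 + \<i> *\<^sub>C complex_matrix S) ** (mat 1 - \<i> *\<^sub>C complex_matrix S)
      = complex_matrix (mat 1 + S ** S)"
    by (simp add: matrix_mul_distribs matrix_add_ldistrib)
      (simp add: vec_eq_iff algebra_simps)
  then have "(mat 1 + \<i> *\<^sub>C complex_matrix S) **
      ((mat 1 - \<i> *\<^sub>C complex_matrix S) ** complex_matrix W) = mat 1"
    using arg_cong [OF W, of complex_matrix] by (simp add: matrix_mul_assoc)
  then show ?thesis
    using invertible_right_inverse by blast
qed

lemma matrix_inv_right_left:
  fixes M :: "'a::semiring_1 ^ 'n ^ 'm"
  assumes "invertible M"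
  shows "M ** matrix_inv M = mat 1" "matrix_inv M ** M = mat 1"
  using someI_ex [OF assms [unfolded invertible_def]] by (simp_all add: matrix_inv_def)

text \<open>As \<open>S\<close> is real, conjugation swaps \<open>P\<close> and \<open>Q\<close>, so
  it turns \<open>Q ** V\<close> into \<open>P ** W\<close>, with \<open>W\<close> the inverse of
  \<open>Q\<close>. Symmetry passes from \<open>S\<close> to all factors, and these commute where
  needed.\<close>

lemma cayley_unitary_sym:
  fixes S :: "real ^ 'n ^ 'n"
  assumes S: "transpose S = S"
  shows "(mat 1 - \<i> *\<^sub>C complex_matrix S) ** matrix_inv (mat 1 + \<i> *\<^sub>C complex_matrix S)
    \<in> unitary_sym"
proof -
  define P where "P = mat 1 + \<i> *\<^sub>C complex_matrix S"
  define Q where "Q = mat 1 - \<i> *\<^sub>C complex_matrix S"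
  define V where "V = matrix_inv P"
  have PV: "P ** V = mat 1" and VP: "V ** P = mat 1"
    using matrix_inv_right_left invertible_mat_1_add_i_symmetric [OF S]
    by (auto simp: V_def P_def)
  have Q: "Q = mat 1 + mat 1 - P"
    by (simp add: P_def Q_def)
  have conj_P: "conj_matrix P = Q" and conj_Q: "conj_matrix Q = P"
    by (simp_all add: P_def Q_def) (simp_all add: vec_eq_iff)
  define W where "W = conj_matrix V"
  have QW: "Q ** W = mat 1"
    using arg_cong [OF PV, of conj_matrix] by (simp add: conj_P W_def)
  \<comment> \<open>\<open>Q\<close> is a polynomial in \<open>P\<close>, hence commutes with the
    inverse of \<open>P\<close>.\<close>
  have VQ: "V ** Q = Q ** V"
    by (simp only: Q matrix_mul_distribs matrix_add_ldistrib PV VP matrix_mul_lid matrix_mul_rid)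
  have PW: "P ** W = W ** P"
    using arg_cong [OF VQ, of conj_matrix] by (simp add: conj_Q W_def)
  have P_sym: "transpose P = P" and Q_sym: "transpose Q = Q"
    using S by (simp_all add: P_def Q_def flip: complex_matrix_simps)
  \<comment> \<open>The transpose of \<open>V\<close> is a left inverse of the symmetric
    \<open>P\<close>, so it agrees with the right inverse \<open>V\<close>.\<close>
  have "transpose V = transpose V ** (P ** V)"
    by (simp add: PV)
  also have "\<dots> = transpose (P ** V) ** V"
    by (simp add: matrix_transpose_mul P_sym matrix_mul_assoc)
  finally have V_sym: "transpose V = V"
    by (simp add: PV)
  have sym: "transpose (Q ** V) = Q ** V"
    by (simp add: matrix_transpose_mul Q_sym V_sym VQ)
  have conj: "transpose (conj_matrix (Q ** V)) = P ** W"
  proof -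
    have "transpose W = W"
      using arg_cong [OF V_sym, of conj_matrix]
      by (simp add: W_def conj_matrix_def vec_eq_iff transpose_def)
    then show ?thesis
      by (simp add: conj_Q matrix_transpose_mul P_sym PW flip: W_def)
  qed
  have "Q ** V ** (P ** W) = Q ** (V ** P) ** W"
    by (simp add: matrix_mul_assoc)
  then have 1: "Q ** V ** (P ** W) = mat 1"
    by (simp add: VP QW)
  then have "P ** W ** (Q ** V) = mat 1"
    using matrix_left_right_inverse by blast
  with 1 show ?thesis
    unfolding unitary_sym_def mem_Collect_eq
    by (simp only: conj sym simp_thms flip: P_def Q_def V_def)
qed

section \<open>The Riccati equation under the Cayley transform\<close>

text \<open>With \<open>T = \<i>s\<close>, the left-hand side is the right-hand side of the equation for \<open>u\<close> multiplied
  by \<open>P\<close> on both sides. Here \<open>a, d\<close> stand for \<open>a/2, d/2\<close> and \<open>b, c\<close> for \<open>\<i>b/2, \<i>c/2\<close>, so that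
  no scalars occur.\<close>

lemma riccati_cayley_conjugation:
  fixes a b c d T :: "'a::ring_1 ^ 'n ^ 'n"
  defines "P \<equiv> mat 1 + T" and "Q \<equiv> mat 1 - T"
  shows "P ** (a - d - (b + c)) ** P + P ** (a + d + (b - c)) ** Q
      - Q ** (a + d - (b - c)) ** P - Q ** (a - d + (b + c)) ** Q =
    (let X = T ** a - d ** T - T ** b ** T - c in X + X + X + X)"
  unfolding assms Let_def
  by (simp only: matrix_mul_distribs matrix_add_ldistrib matrix_mul_assoc
      matrix_mul_lid matrix_mul_rid) (simp only: algebra_simps)

theorem lemma5p1:
  fixes A :: "real \<Rightarrow> real ^ ('n::finite + 'n) ^ ('n + 'n)"
    and a b c d s :: "real \<Rightarrow> real ^ 'n ^ 'n"
    and u C D :: "real \<Rightarrow> complex ^ 'n ^ 'n"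
  assumes A_blocks: "\<And>x. A x = block_matrix (a x) (b x) (c x) (d x)"
    and A_sp: "\<And>x. A x \<in> sp_algebra"
    and s_sym: "\<And>x. s x \<in> sym_matrices"
    and riccati: "\<And>x. (s has_vector_derivative
        (c x + d x ** s x - s x ** (a x + b x ** s x))) (at x)"
    and u_def: "\<And>x. u x = (mat 1 - \<i> *\<^sub>C complex_matrix (s x)) **
        matrix_inv (mat 1 + \<i> *\<^sub>C complex_matrix (s x))"
    and C_def: "\<And>x. C x = (1/2) *\<^sub>C (complex_matrix (a x) - complex_matrix (d x)
        - \<i> *\<^sub>C (complex_matrix (b x) + complex_matrix (c x)))"
    and D_def: "\<And>x. D x = (1/2) *\<^sub>C (complex_matrix (a x) + complex_matrix (d x)
        + \<i> *\<^sub>C (complex_matrix (b x) - complex_matrix (c x)))"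
  shows "(\<forall>x. invertible (mat 1 + \<i> *\<^sub>C complex_matrix (s x))) \<and>
    (\<forall>x. u x \<in> unitary_sym) \<and>
    (\<forall>x. (u has_vector_derivative
        (C x + D x ** u x - u x ** (conj_matrix (D x) + conj_matrix (C x) ** u x))) (at x))"
proof (intro conjI allI)
  fix x
  have s_sym': "transpose (s y) = s y" for y
    using s_sym by (simp add: sym_matrices_def)
  show "invertible (mat 1 + \<i> *\<^sub>C complex_matrix (s x))"
    by (rule invertible_mat_1_add_i_symmetric [OF s_sym'])
  show "u x \<in> unitary_sym"
    unfolding u_def by (rule cayley_unitary_sym [OF s_sym'])
  define P where "P y = mat 1 + \<i> *\<^sub>C complex_matrix (s y)" for y
  define Q where "Q y = mat 1 - \<i> *\<^sub>C complex_matrix (s y)" for y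
  define V where "V y = matrix_inv (P y)" for y
  have PV: "P y ** V y = mat 1" and VP: "V y ** P y = mat 1" for y
    using matrix_inv_right_left invertible_mat_1_add_i_symmetric [OF s_sym']
    by (auto simp: V_def P_def)
  have Q: "Q y = mat 1 + mat 1 - P y" for y
    by (simp add: P_def Q_def)
  \<comment> \<open>Now \<open>u\<close> depends on \<open>x\<close> only through \<open>V\<close>,
    so differentiating the inverse suffices.\<close>
  have u: "u y = V y + V y - mat 1" for y
    by (simp only: u_def Q matrix_mul_distribs PV matrix_mul_lid flip: P_def Q_def V_def)
  have Pu: "P x ** u x = Q x" and uP: "u x ** P x = Q x"
    by (simp_all only: u Q matrix_mul_distribs matrix_add_ldistrib PV VP
        matrix_mul_lid matrix_mul_rid)
  define R where "R = c x + d x ** s x - s x ** (a x + b x ** s x)"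
  define X where "X = C x + D x ** u x - u x ** (conj_matrix (D x) + conj_matrix (C x) ** u x)"
  have "(P has_vector_derivative 0 + \<i> *\<^sub>C complex_matrix R) (at x)"
    unfolding P_def R_def
    by (intro has_vector_derivative_add has_vector_derivative_const
        bounded_linear.has_vector_derivative [OF bounded_linear_i_complex_matrix] riccati)
  then have V': "(V has_vector_derivative - (V x ** (\<i> *\<^sub>C complex_matrix R) ** V x)) (at x)"
    unfolding add_0 by (rule has_vector_derivative_matrix_inverse [OF _ PV])
  \<comment> \<open>Conjugation fixes \<open>a'\<close>, \<open>d'\<close> and negates
    \<open>b'\<close>, \<open>c'\<close>, because the factor \<open>\<i>\<close> sits in the latter.
    So all four coefficients take the form required by
    \<open>riccati_cayley_conjugation\<close>.\<close>
  define a' d' b' c' where "a' = (1/2) *\<^sub>C complex_matrix (a x)"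
    and "d' = (1/2) *\<^sub>C complex_matrix (d x)"
    and "b' = (\<i>/2) *\<^sub>C complex_matrix (b x)"
    and "c' = (\<i>/2) *\<^sub>C complex_matrix (c x)"
  note abcd' = this
  have coeffs: "C x = a' - d' - (b' + c')" "D x = a' + d' + (b' - c')"
    and conj_coeffs: "conj_matrix (D x) = a' + d' - (b' - c')" "conj_matrix (C x) = a' - d' + (b' + c')"
    by (simp_all add: C_def D_def abcd') (simp_all add: vec_eq_iff algebra_simps)
  have "P x ** X ** P x = P x ** C x ** P x + P x ** D x ** (u x ** P x)
      - (P x ** u x) ** conj_matrix (D x) ** P x - (P x ** u x) ** conj_matrix (C x) ** (u x ** P x)"
    unfolding X_def
    by (simp only: matrix_mul_distribs matrix_add_ldistrib matrix_mul_assoc diff_diff_eq)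
  \<comment> \<open>With \<open>T = \<i>s\<close> and the halved coefficients,
    \<open>T a' - d' T - T b' T - c'\<close> equals \<open>- (\<i>/2) R\<close>, where
    \<open>\<i>\<^sup>3 = - \<i>\<close> fixes the sign of the quadratic term. Four copies give the
    factor \<open>- 2\<i>\<close>.\<close>
  also have "\<dots> = (- 2 * \<i>) *\<^sub>C complex_matrix R"
    unfolding Pu uP conj_coeffs unfolding coeffs P_def Q_def riccati_cayley_conjugation
    by (simp only: Let_def R_def abcd' matrix_mul_cscale complex_matrix_simps complex_matrix_mul
        matrix_add_ldistrib matrix_mul_assoc)
      (simp add: vec_eq_iff algebra_simps)
  finally have PXP: "P x ** X ** P x = (- 2 * \<i>) *\<^sub>C complex_matrix R" .
  \<comment> \<open>Multiplying by \<open>V x\<close> on both sides undoes the multiplication by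
    \<open>P x\<close> and recovers \<open>X\<close>.\<close>
  have "X = (V x ** P x) ** X ** (P x ** V x)"
    by (simp add: PV VP)
  also have "\<dots> = V x ** (P x ** X ** P x) ** V x"
    by (simp add: matrix_mul_assoc)
  \<comment> \<open>Two equal summands minus zero: the shape that the sum and difference rules
    produce for \<open>V + V - 1\<close>.\<close>
  finally have X: "X = - (V x ** (\<i> *\<^sub>C complex_matrix R) ** V x)
      + - (V x ** (\<i> *\<^sub>C complex_matrix R) ** V x) - 0"
    by (simp add: PXP) (simp add: vec_eq_iff)
  have "((\<lambda>y. V y + V y - mat 1) has_vector_derivative X) (at x)"
    unfolding X by (intro has_vector_derivative_add has_vector_derivative_diff
        has_vector_derivative_const V')
  then have "(u has_vector_derivative X) (at x)"
    by (simp only: flip: u)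
  then show "(u has_vector_derivative
      (C x + D x ** u x - u x ** (conj_matrix (D x) + conj_matrix (C x) ** u x))) (at x)"
    unfolding X_def .
qed

end
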